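(* Let $\mathcal{A}$ be an almost disjoint family of subsets of $\mathbb{N}$ with $|\mathcal{A}|=2^{\aleph_0}$. Then $S_{\mathcal{A}}$ is incomparable under $\preccurlyeq$ to $\mathfrak{F}$ and to $\mathfrak{F}_n$ for every $n\geq 2$; that is, for $X\in\{\mathfrak{F}\}\cup\{\mathfrak{F}_n: n\geq 2\}$, neither $S_{\mathcal{A}}\preccurlyeq X$ nor $X\preccurlyeq S_{\mathcal{A}}$.
   Context: $\mathbb{N}=\{0,1,2,\ldots\}$ and $\mathbb{N}^\mathbb{N}$ is the semigroup of all maps $\mathbb{N}\to\mathbb{N}$ under composition. For $U,V\subseteq\mathbb{N}^\mathbb{N}$, write $U\preccurlyeq V$ if there is a countable $C\subseteq\mathbb{N}^\mathbb{N}$ such that $U$ is contained in the subsemigroup generated by $V\cup C$. For $n\geq 2$, $\mathfrak{F}_n=\{f\in\mathbb{N}^\mathbb{N}: |f(\mathbb{N})|\leq n\}$, and $\mathfrak{F}=\bigcup_{n}\mathfrak{F}_n$ (all maps with finite image). A family $\mathcal{A}$ of subsets of $\mathbb{N}$ is almost disjoint if $A\cap B$ is finite for all distinct $A,B\in\mathcal{A}$. For $A\subseteq\mathbb{N}$, $s_A\in\mathbb{N}^\mathbb{N}$ is defined by $s_A(n)=n$ if $n\in A$ and $s_A(n)=0$ if $n\notin A$; and $S_{\mathcal{A}}=\{s_A: A\in\mathcal{A}\}$. *)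

theory Defs
  imports "HOL-Library.Countable_Set" "HOL-Library.Equipollence"
begin

inductive_set semigroup_gen :: "('a \<Rightarrow> 'a) set \<Rightarrow> ('a \<Rightarrow> 'a) set"
  for G :: "('a \<Rightarrow> 'a) set" where
  gen: "f \<in> G \<Longrightarrow> f \<in> semigroup_gen G"
| comp: "f \<in> semigroup_gen G \<Longrightarrow> g \<in> semigroup_gen G \<Longrightarrow> f \<circ> g \<in> semigroup_gen G"

definition preceq :: "(nat \<Rightarrow> nat) set \<Rightarrow> (nat \<Rightarrow> nat) set \<Rightarrow> bool" (infix "\<preceq>" 50) where
  "U \<preceq> V \<longleftrightarrow> (\<exists>C. countable C \<and> U \<subseteq> semigroup_gen (V \<union> C))"

definition incomparable :: "(nat \<Rightarrow> nat) set \<Rightarrow> (nat \<Rightarrow> nat) set \<Rightarrow> bool" where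
  "incomparable U V \<longleftrightarrow> \<not> U \<preceq> V \<and> \<not> V \<preceq> U"

text \<open>The finiteness conjunct is needed because \<^term>\<open>card\<close> is 0 on infinite sets.\<close>

definition Fin_maps_le :: "nat \<Rightarrow> (nat \<Rightarrow> nat) set" where
  "Fin_maps_le n = {f. finite (range f) \<and> card (range f) \<le> n}"

definition Fin_maps :: "(nat \<Rightarrow> nat) set" where
  "Fin_maps = (\<Union>n\<in>{2..}. Fin_maps_le n)"

lemma Fin_maps_eq: "Fin_maps = {f. finite (range f)}"
proof -
  have "\<exists>n\<in>{2..}. k \<le> n" for k :: nat
    by (rule bexI[of _ "max 2 k"]) auto
  then show ?thesis
    by (auto simp: Fin_maps_def Fin_maps_le_def)
qed

definition almost_disjoint :: "nat set set \<Rightarrow> bool" where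
  "almost_disjoint \<A> \<longleftrightarrow> (\<forall>A\<in>\<A>. \<forall>B\<in>\<A>. A \<noteq> B \<longrightarrow> finite (A \<inter> B))"

definition s_map :: "nat set \<Rightarrow> nat \<Rightarrow> nat" where
  "s_map A n = (if n \<in> A then n else 0)"

definition S_fam :: "nat set set \<Rightarrow> (nat \<Rightarrow> nat) set" where
  "S_fam \<A> = {s_map A | A. A \<in> \<A>}"

end

theory Submission
  imports Defs
begin

text \<open>
  The finite-image maps form an ideal, so adjoining a countable set \<open>C\<close> to them produces only
  countably many maps with infinite image, whereas \<open>s\<^sub>A\<close> has infinite image for uncountably many
  \<open>A \<in> \<A>\<close>.

  For the other direction, let \<open>C\<close> be countable. If \<open>m\<close> has infinite image, then at most one
  \<open>A \<in> \<A>\<close> contains the image of \<open>m\<close> up to finitely many points. Closing \<open>{id}\<close> under left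
  multiplication by \<open>C\<close> and under \<open>m \<mapsto> s\<^sub>A \<circ> m\<close> for this exceptional \<open>A\<close> gives a countable set \<open>M\<close>.
  Every product of generators either lies in \<open>M\<close> or has the form \<open>g \<circ> s\<^sub>A \<circ> m\<close> with \<open>m \<in> M\<close> and \<open>A\<close>
  not exceptional for \<open>m\<close>. Each \<open>m \<in> M\<close> comes with two infinite sets such that every \<open>g \<circ> s\<^sub>A \<circ> m\<close>
  of the latter form, as well as \<open>m\<close> itself if its image is finite, is constant up to finitely many
  points on one of them. A two-valued map taking both values infinitely often on each of these
  countably many infinite sets is therefore not generated.
\<close>

section \<open>Generated semigroups and monotonicity of the preorder\<close>

lemma semigroup_gen_mono: "G \<subseteq> H \<Longrightarrow> semigroup_gen G \<subseteq> semigroup_gen H"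
proof
  fix f assume "G \<subseteq> H" and "f \<in> semigroup_gen G"
  from this(2) show "f \<in> semigroup_gen H"
    by induction (use \<open>G \<subseteq> H\<close> in \<open>blast intro: semigroup_gen.intros\<close>)+
qed

lemma preceq_mono: "U' \<subseteq> U \<Longrightarrow> V \<subseteq> V' \<Longrightarrow> U \<preceq> V \<Longrightarrow> U' \<preceq> V'"
proof -
  assume U: "U' \<subseteq> U" and V: "V \<subseteq> V'" and "U \<preceq> V"
  then obtain C where C: "countable C" "U \<subseteq> semigroup_gen (V \<union> C)"
    by (auto simp: preceq_def)
  have "semigroup_gen (V \<union> C) \<subseteq> semigroup_gen (V' \<union> C)"
    using V by (intro semigroup_gen_mono) auto
  then show "U' \<preceq> V'" using U C unfolding preceq_def by blast
qed

text \<open>Each generated map is the product of a finite list over \<open>C\<close>, and there are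
  only countably many such lists.\<close>

lemma countable_semigroup_gen:
  assumes "countable C"
  shows "countable (semigroup_gen C)"
proof -
  let ?prod = "\<lambda>fs. foldr (\<circ>) fs id"
  have prod_append: "?prod (fs @ gs) = ?prod fs \<circ> ?prod gs" for fs gs :: "('a \<Rightarrow> 'a) list"
    by (induction fs) (auto simp: comp_assoc)
  have "f \<in> ?prod ` lists C" if "f \<in> semigroup_gen C" for f
    using that
  proof induction
    case (gen f)
    then show ?case by (intro image_eqI[of _ _ "[f]"]) auto
  next
    case (comp f g)
    then obtain fs gs where "f = ?prod fs" "fs \<in> lists C" "g = ?prod gs" "gs \<in> lists C"
      by blast
    then have "f \<circ> g = ?prod (fs @ gs)" "fs @ gs \<in> lists C"
      using prod_append[of fs gs] by simp_all
    then show ?case by (rule image_eqI)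
  qed
  then show ?thesis
    using assms by (meson countable_image countable_lists countable_subset subsetI)
qed

section \<open>Finite-image maps do not generate the maps \<open>s_map A\<close>\<close>

lemma semigroup_gen_Fin_maps_Un:
  assumes "f \<in> semigroup_gen (Fin_maps \<union> C)"
  shows "finite (range f) \<or> f \<in> semigroup_gen C"
  using assms
proof induction
  case (gen f)
  then show ?case by (auto simp: Fin_maps_eq intro: semigroup_gen.gen)
next
  case (comp f g)
  have "finite (range (f \<circ> g))" if "finite (range f)"
    using that by (rule rev_finite_subset) auto
  moreover have "finite (range (f \<circ> g))" if "finite (range g)"
    using that by (metis finite_imageI image_comp)
  ultimately show ?case
    using comp.IH by (blast intro: semigroup_gen.comp)
qed

lemma range_s_map: "A \<subseteq> range (s_map A)"
proof
  fix n assume "n \<in> A"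
  then show "n \<in> range (s_map A)"
    by (intro image_eqI[of _ _ n]) (auto simp: s_map_def)
qed

lemma inj_on_s_map_infinite:
  assumes "almost_disjoint \<A>"
  shows "inj_on s_map {A \<in> \<A>. infinite A}"
proof (rule inj_onI)
  fix A B assume A: "A \<in> {A \<in> \<A>. infinite A}" and B: "B \<in> {A \<in> \<A>. infinite A}"
    and eq: "s_map A = s_map B"
  \<comment> \<open>The point 0 is left out because \<open>s_map A 0 = 0\<close> whether or not 0
    lies in \<open>A\<close>.\<close>
  have "n \<in> B" if "n \<in> A - {0}" for n
    using fun_cong[OF eq, of n] that by (auto simp: s_map_def split: if_splits)
  then have "A - {0} \<subseteq> A \<inter> B" by blast
  moreover have "infinite (A - {0})" using A by simp
  ultimately have "infinite (A \<inter> B)" by (meson finite_subset)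
  then show "A = B" using A B assms by (auto simp: almost_disjoint_def)
qed

lemma uncountable_if_eqpoll_nat_sets:
  assumes "\<A> \<approx> (UNIV :: nat set set)"
  shows "uncountable \<A>"
proof
  assume "countable \<A>"
  moreover obtain h where "bij_betw h \<A> (UNIV :: nat set set)"
    using assms by (auto simp: eqpoll_def)
  ultimately have "countable (UNIV :: nat set set)"
    by (metis bij_betw_def countable_image)
  then obtain e :: "nat \<Rightarrow> nat set" where "range e = UNIV"
    by (metis UNIV_not_empty uncountable_def)
  then show False
    using Cantors_theorem[of "UNIV :: nat set"] by auto
qed

lemma S_fam_not_preceq_Fin_maps:
  assumes "almost_disjoint \<A>" and "\<A> \<approx> (UNIV :: nat set set)"
  shows "\<not> S_fam \<A> \<preceq> Fin_maps"
proof
  assume "S_fam \<A> \<preceq> Fin_maps"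
  then obtain C where C: "countable C" "S_fam \<A> \<subseteq> semigroup_gen (Fin_maps \<union> C)"
    by (auto simp: preceq_def)
  let ?I = "{A \<in> \<A>. infinite A}"
  have "s_map ` ?I \<subseteq> semigroup_gen C"
  proof clarify
    fix A assume A: "A \<in> \<A>" "infinite A"
    then have "infinite (range (s_map A))"
      by (meson finite_subset range_s_map)
    moreover have "s_map A \<in> semigroup_gen (Fin_maps \<union> C)"
      using A C(2) by (auto simp: S_fam_def)
    ultimately show "s_map A \<in> semigroup_gen C"
      using semigroup_gen_Fin_maps_Un by blast
  qed
  then have "countable (s_map ` ?I)"
    using C(1) countable_semigroup_gen countable_subset by blast
  then have "countable ?I"
    using inj_on_s_map_infinite[OF assms(1)] countable_image_inj_on by blast
  \<comment> \<open>Members of \<open>\<A>\<close> may be finite, but there are only countably many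
    finite sets of naturals.\<close>
  moreover have "countable {A \<in> \<A>. finite A}"
    by (rule countable_subset[OF _ countable_Collect_finite]) auto
  ultimately have "countable (?I \<union> {A \<in> \<A>. finite A})"
    by (rule countable_Un)
  moreover have "?I \<union> {A \<in> \<A>. finite A} = \<A>" by auto
  ultimately show False
    using uncountable_if_eqpoll_nat_sets[OF assms(2)] by simp
qed

section \<open>Splitting countably many infinite sets\<close>

lemma splitting_map_exists:
  assumes "countable \<X>" and inf: "\<And>X. X \<in> \<X> \<Longrightarrow> infinite (X :: nat set)"
  obtains f :: "nat \<Rightarrow> nat" where "range f \<subseteq> {0, 1}"
    and "\<And>X v. X \<in> \<X> \<Longrightarrow> infinite {x \<in> X. f x \<noteq> v}"
proof (cases "\<X> = {}")
  case True
  then show ?thesis using that[of "\<lambda>_. 0"] by auto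
next
  case False
  define e where "e = from_nat_into \<X>"
  have e: "range e = \<X>"
    unfolding e_def using False assms(1) by (rule range_from_nat_into)
  \<comment> \<open>Dovetailing: the sequence \<open>?X\<close> visits each member of
    \<open>\<X>\<close> infinitely often, so each visit can pick a point beyond all earlier
    ones.\<close>
  let ?X = "\<lambda>n. e (fst (prod_decode n))"
  have infX: "infinite (?X n)" for n
    using e inf by blast
  have "\<exists>h. \<forall>n. h n \<in> ?X n \<and> h n < h (Suc n)"
  proof (rule dependent_nat_choice)
    show "\<exists>x. x \<in> ?X 0" using infX[of 0] infinite_imp_nonempty by blast
    show "\<exists>y. y \<in> ?X (Suc n) \<and> x < y" for x n
      using infX[of "Suc n"] unfolding infinite_nat_iff_unbounded by blast
  qed
  then obtain h where h: "\<And>n. h n \<in> ?X n" and "\<And>n. h n < h (Suc n)"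
    by blast
  then have inj: "inj h"
    by (simp add: strict_mono_Suc_iff strict_mono_imp_inj_on)
  define f :: "nat \<Rightarrow> nat" where "f x = of_bool (\<exists>n. x = h n \<and> even (snd (prod_decode n)))" for x
  have f_h: "f (h (prod_encode (k, j))) = of_bool (even j)" for k j
    using inj by (auto simp: f_def inj_eq)
  show ?thesis
  proof
    show "range f \<subseteq> {0, 1}" by (auto simp: f_def)
    fix X and v :: nat assume "X \<in> \<X>"
    then obtain k where k: "X = e k" using e by blast
    \<comment> \<open>\<open>f\<close> is 1 at even visits and 0 at odd ones; \<open>b\<close>
      selects a parity at which the value differs from \<open>v\<close>.\<close>
    define b :: nat where "b = of_bool (v = 1)"
    have b: "of_bool (even (2 * i + b)) \<noteq> v" for i :: nat
      by (auto simp: b_def)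
    let ?g = "\<lambda>i. h (prod_encode (k, 2 * i + b))"
    have "inj ?g"
      by (rule injI) (simp add: inj_eq[OF inj])
    then have "infinite (range ?g)"
      by (rule range_inj_infinite)
    moreover have "?g i \<in> {x \<in> X. f x \<noteq> v}" for i
      using h[of "prod_encode (k, 2 * i + b)"] b k f_h by simp
    ultimately show "infinite {x \<in> X. f x \<noteq> v}"
      by (meson finite_subset image_subsetI)
  qed
qed

section \<open>Exceptional sets and the countable closure\<close>

definition exceptional :: "(nat \<Rightarrow> nat) \<Rightarrow> nat set \<Rightarrow> bool" where
  "exceptional m A \<longleftrightarrow> infinite (range m) \<and> finite (range m - A)"

text \<open>A point of \<open>range m\<close> lies outside \<open>A\<close>, outside
  \<open>B\<close> or in \<open>A \<inter> B\<close>; for \<open>A \<noteq> B\<close> all three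
  parts would be finite. If \<open>range m\<close> were finite, every set would leave a finite
  remainder, hence the infinity clause in \<open>exceptional\<close>.\<close>

lemma exceptional_unique:
  assumes "almost_disjoint \<A>" "A \<in> \<A>" "B \<in> \<A>" "exceptional m A" "exceptional m B"
  shows "A = B"
proof (rule ccontr)
  assume "A \<noteq> B"
  then have "finite ((range m - A) \<union> (range m - B) \<union> (A \<inter> B))"
    using assms by (auto simp: almost_disjoint_def exceptional_def)
  then have "finite (range m)" by (rule rev_finite_subset) blast
  then show False using assms by (simp add: exceptional_def)
qed

text \<open>By uniqueness, composing with the exceptional \<open>s_map A\<close> is one unary
  operation, so finite words over countably many operations applied to \<open>id\<close>
  suffice.\<close>

lemma countable_closure_exists:
  assumes ad: "almost_disjoint \<A>" and "countable C"
  obtains M where "countable M" "id \<in> M" "\<And>c m. c \<in> C \<Longrightarrow> m \<in> M \<Longrightarrow> c \<circ> m \<in> M"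
    and "\<And>A m. A \<in> \<A> \<Longrightarrow> m \<in> M \<Longrightarrow> exceptional m A \<Longrightarrow> s_map A \<circ> m \<in> M"
proof
  \<comment> \<open>If \<open>m\<close> has no exceptional set in \<open>\<A>\<close>,
    \<open>THE\<close> yields an arbitrary set; this may enlarge \<open>?M\<close> but keeps it
    countable.\<close>
  let ?t = "\<lambda>m. s_map (THE A. A \<in> \<A> \<and> exceptional m A) \<circ> m"
  let ?K = "insert ?t ((\<circ>) ` C)"
  let ?eval = "\<lambda>ks. foldr (\<lambda>k m. k m) ks id"
  let ?M = "?eval ` lists ?K"
  have closed: "k m \<in> ?M" if "k \<in> ?K" "m \<in> ?M" for k m
  proof -
    from that(2) obtain ks where "m = ?eval ks" "ks \<in> lists ?K" by blast
    then show ?thesis using that(1) by (intro image_eqI[of _ _ "k # ks"]) auto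
  qed
  show "countable ?M" using \<open>countable C\<close> by (intro countable_image countable_lists) auto
  show "id \<in> ?M" by (intro image_eqI[of _ _ "[]"]) auto
  show "c \<circ> m \<in> ?M" if "c \<in> C" "m \<in> ?M" for c m
    using closed[of "(\<circ>) c" m] that by blast
  show "s_map A \<circ> m \<in> ?M" if "A \<in> \<A>" "m \<in> ?M" "exceptional m A" for A m
  proof -
    have "(THE A. A \<in> \<A> \<and> exceptional m A) = A"
      by (rule the_equality) (use that exceptional_unique[OF ad] in blast)+
    then show ?thesis using closed[of ?t m] that(2) by simp
  qed
qed

lemma generated_factorisation:
  assumes C: "\<And>c m. c \<in> C \<Longrightarrow> m \<in> M \<Longrightarrow> c \<circ> m \<in> M"
    and s: "\<And>A m. A \<in> \<A> \<Longrightarrow> m \<in> M \<Longrightarrow> exceptional m A \<Longrightarrow> s_map A \<circ> m \<in> M"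
    and "id \<in> M" and "f \<in> semigroup_gen (S_fam \<A> \<union> C)"
  shows "f \<in> M \<or> (\<exists>g A m. f = g \<circ> s_map A \<circ> m \<and> A \<in> \<A> \<and> m \<in> M \<and> \<not> exceptional m A)"
proof -
  let ?Q = "\<lambda>f. \<exists>g A m. f = g \<circ> s_map A \<circ> m \<and> A \<in> \<A> \<and> m \<in> M \<and> \<not> exceptional m A"
  have left: "?Q (h \<circ> t)" if "?Q t" for h t :: "nat \<Rightarrow> nat"
    using that by (metis comp_assoc)
  \<comment> \<open>Generalising over a right factor \<open>h\<close> lets a product
    \<open>f \<circ> g\<close> act one factor at a time, first \<open>g\<close> and then
    \<open>f\<close>. Once \<open>?Q\<close> holds, further factors are absorbed into the left
    map.\<close>
  from assms(4) have "h \<in> M \<or> ?Q h \<Longrightarrow> f \<circ> h \<in> M \<or> ?Q (f \<circ> h)" for h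
  proof (induction arbitrary: h)
    case (gen f)
    from gen.prems show ?case
    proof
      assume "?Q h"
      then show ?thesis using left by blast
    next
      assume h: "h \<in> M"
      from gen.hyps show ?thesis
      proof
        assume "f \<in> C"
        then show ?thesis using C h by blast
      next
        assume "f \<in> S_fam \<A>"
        then obtain A where A: "A \<in> \<A>" "f = s_map A" by (auto simp: S_fam_def)
        show ?thesis
        proof (cases "exceptional h A")
          case True
          then show ?thesis using s A h by blast
        next
          case False
          then have "?Q (f \<circ> h)"
            using A h by (intro exI[of _ id] exI[of _ A] exI[of _ h]) auto
          then show ?thesis ..
        qed
      qed
    qed
  next
    case (comp f g)
    have "f \<circ> (g \<circ> h) \<in> M \<or> ?Q (f \<circ> (g \<circ> h))"
      by (rule comp.IH(1)[OF comp.IH(2)[OF comp.prems]])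
    then show ?case by (simp only: comp_assoc)
  qed
  from this[of id] show ?thesis using \<open>id \<in> M\<close> by simp
qed

section \<open>Test sets for the maps in the closure\<close>

lemma infinite_section:
  assumes "infinite E" "E \<subseteq> range m"
  obtains X where "infinite X" "inj_on m X" "m ` X = E"
proof
  show "m ` (inv m ` E) = E"
    using assms(2) by (auto simp: image_image f_inv_into_f subset_iff)
  show "inj_on m (inv m ` E)"
    using assms(2) by (auto simp: inj_on_def f_inv_into_f subset_iff)
  show "infinite (inv m ` E)"
    using assms by (meson finite_imageD inj_on_inv_into)
qed

text \<open>
  If \<open>m\<close> has finite image, an infinite fibre serves as both sets. Otherwise choose sections over
  \<open>range m \<inter> B\<close> and \<open>range m - B\<close> for some \<open>B \<in> \<A>\<close> meeting the image infinitely often: \<open>B\<close> misses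
  the second of these, and any other member of \<open>\<A>\<close> almost misses the first.
\<close>

lemma test_sets_exist:
  assumes ad: "almost_disjoint \<A>"
  obtains X Y where "infinite X" "infinite Y"
    and "finite (range m) \<Longrightarrow> \<exists>v. \<forall>x\<in>X. m x = v"
    and "\<And>g A. A \<in> \<A> \<Longrightarrow> \<not> exceptional m A \<Longrightarrow>
      \<exists>v. finite {x \<in> X. (g \<circ> s_map A \<circ> m) x \<noteq> v} \<or> finite {x \<in> Y. (g \<circ> s_map A \<circ> m) x \<noteq> v}"
proof (cases "finite (range m)")
  case True
  then obtain y where y: "infinite (m -` {y})"
    by (metis inf_img_fin_dom infinite_UNIV_nat)
  have "{x \<in> m -` {y}. (g \<circ> s_map A \<circ> m) x \<noteq> g (s_map A y)} = {}" for g A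
    by auto
  then have "finite {x \<in> m -` {y}. (g \<circ> s_map A \<circ> m) x \<noteq> g (s_map A y)}" for g A
    by (metis finite.emptyI)
  then show ?thesis
    by (intro that[OF y y]) blast+
next
  case False
  \<comment> \<open>Points that \<open>m\<close> sends outside \<open>A\<close> are mapped to
    \<open>g 0\<close>; injectivity on \<open>X\<close> leaves finitely many others.\<close>
  have small: "finite {x \<in> X. (g \<circ> s_map A \<circ> m) x \<noteq> g 0}"
    if "inj_on m X" "finite (A \<inter> m ` X)" for g A X
  proof (rule inj_on_finite)
    show "inj_on m {x \<in> X. (g \<circ> s_map A \<circ> m) x \<noteq> g 0}"
      using that(1) by (rule inj_on_subset) auto
    show "m ` {x \<in> X. (g \<circ> s_map A \<circ> m) x \<noteq> g 0} \<subseteq> A \<inter> m ` X"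
      by (auto simp: s_map_def)
  qed (rule that(2))
  show ?thesis
  proof (cases "\<exists>B\<in>\<A>. infinite (range m \<inter> B) \<and> \<not> exceptional m B")
    case True
    then obtain B where B: "B \<in> \<A>" "infinite (range m \<inter> B)" "infinite (range m - B)"
      using False by (auto simp: exceptional_def)
    obtain X where X: "infinite X" "inj_on m X" "m ` X = range m \<inter> B"
      using infinite_section[OF B(2)] by blast
    obtain Y where Y: "infinite Y" "inj_on m Y" "m ` Y = range m - B"
      using infinite_section[OF B(3)] by blast
    have *: "finite (A \<inter> m ` X) \<or> finite (A \<inter> m ` Y)" if "A \<in> \<A>" for A
    proof (cases "A = B")
      case True
      then have "A \<inter> m ` Y = {}" using Y(3) by blast
      then show ?thesis by simp
    next
      case False
      then have "finite (A \<inter> B)" using ad B(1) that by (auto simp: almost_disjoint_def)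
      then have "finite (A \<inter> m ` X)" by (rule rev_finite_subset) (use X(3) in blast)
      then show ?thesis ..
    qed
    show ?thesis
    proof (rule that[OF X(1) Y(1)])
      fix g :: "nat \<Rightarrow> 'b" and A assume "A \<in> \<A>"
      then show "\<exists>v. finite {x \<in> X. (g \<circ> s_map A \<circ> m) x \<noteq> v} \<or>
          finite {x \<in> Y. (g \<circ> s_map A \<circ> m) x \<noteq> v}"
        using * small X(2) Y(2) by blast
    qed (use False in simp)
  next
    case none: False
    \<comment> \<open>Here every non-exceptional member of \<open>\<A>\<close> meets
      \<open>range m\<close> in a finite set, so one section over the whole image serves as both
      sets.\<close>
    obtain X where X: "infinite X" "inj_on m X" "m ` X = range m"
      using infinite_section[OF False order_refl] by blast
    show ?thesis
    proof (rule that[OF X(1) X(1)])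
      fix g :: "nat \<Rightarrow> 'b" and A assume "A \<in> \<A>" "\<not> exceptional m A"
      then have "finite (A \<inter> m ` X)" using none X(3) by (auto simp: Int_commute)
      then show "\<exists>v. finite {x \<in> X. (g \<circ> s_map A \<circ> m) x \<noteq> v} \<or>
          finite {x \<in> X. (g \<circ> s_map A \<circ> m) x \<noteq> v}"
        using small X(2) by blast
    qed (use False in simp)
  qed
qed

section \<open>A two-valued map that is not generated\<close>

lemma Fin_maps_le_2_not_preceq_S_fam:
  assumes ad: "almost_disjoint \<A>"
  shows "\<not> Fin_maps_le 2 \<preceq> S_fam \<A>"
proof
  assume "Fin_maps_le 2 \<preceq> S_fam \<A>"
  then obtain C where C: "countable C" "Fin_maps_le 2 \<subseteq> semigroup_gen (S_fam \<A> \<union> C)"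
    by (auto simp: preceq_def)
  obtain M where M: "countable M" "id \<in> M" "\<And>c m. c \<in> C \<Longrightarrow> m \<in> M \<Longrightarrow> c \<circ> m \<in> M"
      "\<And>A m. A \<in> \<A> \<Longrightarrow> m \<in> M \<Longrightarrow> exceptional m A \<Longrightarrow> s_map A \<circ> m \<in> M"
    by (rule countable_closure_exists[OF ad C(1)]) blast
  define T where "T m X Y \<longleftrightarrow> infinite X \<and> infinite Y \<and>
      (finite (range m) \<longrightarrow> (\<exists>v. \<forall>x\<in>X. m x = v)) \<and>
      (\<forall>(g :: nat \<Rightarrow> nat) A. A \<in> \<A> \<longrightarrow> \<not> exceptional m A \<longrightarrow>
        (\<exists>v. finite {x \<in> X. (g \<circ> s_map A \<circ> m) x \<noteq> v} \<or> finite {x \<in> Y. (g \<circ> s_map A \<circ> m) x \<noteq> v}))"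
    for m X Y
  have "\<exists>X Y. T m X Y" for m
    unfolding T_def by (rule test_sets_exist[OF ad, of m]) blast
  then obtain X Y where "\<And>m. T m (X m) (Y m)"
    by metis
  then have XY: "\<And>m. infinite (X m)" "\<And>m. infinite (Y m)"
      "\<And>m. finite (range m) \<Longrightarrow> \<exists>v. \<forall>x\<in>X m. m x = v"
      "\<And>(g :: nat \<Rightarrow> nat) A m. A \<in> \<A> \<Longrightarrow> \<not> exceptional m A \<Longrightarrow>
        \<exists>v. finite {x \<in> X m. (g \<circ> s_map A \<circ> m) x \<noteq> v} \<or> finite {x \<in> Y m. (g \<circ> s_map A \<circ> m) x \<noteq> v}"
    unfolding T_def by blast+
  have "countable (X ` M \<union> Y ` M)" using M(1) by simp
  moreover have "infinite Z" if "Z \<in> X ` M \<union> Y ` M" for Z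
    using that XY(1,2) by blast
  ultimately obtain f :: "nat \<Rightarrow> nat" where f: "range f \<subseteq> {0, 1}"
      "\<And>Z v. Z \<in> X ` M \<union> Y ` M \<Longrightarrow> infinite {x \<in> Z. f x \<noteq> v}"
    by (rule splitting_map_exists) blast+
  have fin: "finite (range f)" using f(1) by (rule finite_subset) simp
  have "card (range f) \<le> card {0, 1 :: nat}" using f(1) by (intro card_mono) auto
  then have "f \<in> Fin_maps_le 2" using fin by (simp add: Fin_maps_le_def)
  then have "f \<in> semigroup_gen (S_fam \<A> \<union> C)" using C(2) by blast
  from generated_factorisation[OF M(3,4,2) this] show False
  proof
    \<comment> \<open>Now \<open>f\<close> indexes its own test set: its image is finite, so it is
      constant on \<open>X f\<close>, which it was chosen to split.\<close>
    assume "f \<in> M"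
    moreover obtain v where "\<forall>x\<in>X f. f x = v" using XY(3)[OF fin] by blast
    then have "{x \<in> X f. f x \<noteq> v} = {}" by blast
    ultimately show False using f(2)[of "X f" v] by (metis UnI1 finite.emptyI imageI)
  next
    assume "\<exists>g A m. f = g \<circ> s_map A \<circ> m \<and> A \<in> \<A> \<and> m \<in> M \<and> \<not> exceptional m A"
    then obtain g A m where "f = g \<circ> s_map A \<circ> m" "A \<in> \<A>" "m \<in> M" "\<not> exceptional m A"
      by blast
    then show False using XY(4)[of A m g] f(2)[of "X m"] f(2)[of "Y m"] by blast
  qed
qed

theorem theorem4p1:
  fixes \<A> :: "nat set set"
  assumes "almost_disjoint \<A>"
    and "\<A> \<approx> (UNIV :: nat set set)"
  shows "\<forall>X \<in> {Fin_maps} \<union> {Fin_maps_le n | n. n \<ge> 2}. incomparable (S_fam \<A>) X"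
proof
  fix X assume "X \<in> {Fin_maps} \<union> {Fin_maps_le n | n. n \<ge> 2}"
  \<comment> \<open>With \<open>X\<close> between these two extremes, \<open>preceq_mono\<close>
    reduces each direction to one of them.\<close>
  then have "Fin_maps_le 2 \<subseteq> X" "X \<subseteq> Fin_maps"
    by (auto simp: Fin_maps_eq Fin_maps_le_def)
  then show "incomparable (S_fam \<A>) X"
    unfolding incomparable_def
    using S_fam_not_preceq_Fin_maps[OF assms] Fin_maps_le_2_not_preceq_S_fam[OF assms(1)]
    by (meson order_refl preceq_mono)
qed

end
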